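(* Let $\Omega$ be a nonempty finite set. Consider two decision problems $M$ and $L$ on $\Omega$, given by two utility functions $U_M\colon A_M\times\Omega\to\mathbb{R}$ and $U_L\colon A_L\times\Omega\to\mathbb{R}$, where $A_M$ and $A_L$ are nonempty sets. Suppose that the value functions $V_{U_M}$ and $V_{U_L}$ take finite values on $\Delta(\Omega)$. Then the following two statements are equivalent. (1) Decision problem $M$ values information more than decision problem $L$, in the sense that $$\mathrm{VoI}_{U_M}(Q)\;\geq\;\mathrm{VoI}_{U_L}(Q)\quad\text{for all } Q\in\Delta\big(\Delta(\Omega)\big).$$ (2) There exists a decision problem $U_N\colon A_N\times\Omega\to\mathbb{R}$ (with $A_N$ a nonempty set), whose value function $V_{U_N}$ takes finite values on $\Delta(\Omega)$, such that, if one forms the new decision problem $\widetilde{M}$ with Cartesian product decision set $A_{\widetilde{M}}=A_L\times A_N$ and additively separable utility function $U_{\widetilde{M}}\colon (A_L\times A_N)\times\Omega\to\mathbb{R}$ defined by $$U_{\widetilde{M}}\big((l,n),\omega\big)=U_L(l,\omega)+U_N(n,\omega)\quad\text{for all }(l,n)\in A_L\times A_N,\ \omega\in\Omega,$$ then the value functions of $\widetilde{M}$ and $M$ are identical: $$V_{U_{\widetilde{M}}}=V_{U_M}\quad\text{on }\Delta(\Omega).$$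
   Context: $\Omega$ is a nonempty finite set (states of nature). The set of beliefs is the simplex $\Delta(\Omega)=\{p\in\mathbb{R}_+^{\Omega} : \sum_{\omega\in\Omega}p(\omega)=1\}\subset\mathbb{R}^{\Omega}$, where $\mathbb{R}_+=[0,+\infty)$. A decision problem on $\Omega$ is given by a utility function $U\colon A\times\Omega\to\mathbb{R}$, where $A$ is a nonempty (arbitrary) set of decisions/actions. Its value function is $$V_U\colon\Delta(\Omega)\to\mathbb{R}\cup\{-\infty,+\infty\},\qquad V_U(p)=\sup_{a\in A}\sum_{\omega\in\Omega}p(\omega)\,U(a,\omega)\quad\text{for all }p\in\Delta(\Omega).$$ Only decision problems whose value function takes finite values on $\Delta(\Omega)$ are considered; in that case $V_U\colon\Delta(\Omega)\to\mathbb{R}$ is convex, continuous and bounded. $\Delta(\Delta(\Omega))$ denotes the set of (Borel) probability distributions on $\Delta(\Omega)$ (distributions of posterior beliefs). For a decision problem $U$ with finite value function, the value of information is $$\mathrm{VoI}_U(Q)=\int_{\Delta(\Omega)}V_U(p)\,\mathrm{d}Q(p)-V_U\Big(\int_{\Delta(\Omega)}p\,\mathrm{d}Q(p)\Big)\quad\text{for all }Q\in\Delta(\Delta(\Omega)),$$ where $\int_{\Delta(\Omega)}p\,\mathrm{d}Q(p)\in\Delta(\Omega)$ is the barycenter of $Q$ (the prior belief). *)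

theory Defs
  imports "HOL-Probability.Probability"
begin

(* States of nature are the elements of a finite type 'w (automatically nonempty). *)

definition beliefs :: "(real ^ 'w::finite) set"
  where "beliefs = {p. (\<forall>\<omega>. 0 \<le> p $ \<omega>) \<and> (\<Sum>\<omega>\<in>UNIV. p $ \<omega>) = 1}"

(* A decision problem is a pair of a set A of actions and a utility function U, whose values
   outside A are irrelevant. The supremum is taken in the extended reals. *)
definition value_fun :: "'a set \<Rightarrow> ('a \<Rightarrow> 'w::finite \<Rightarrow> real) \<Rightarrow> real ^ 'w \<Rightarrow> ereal"
  where "value_fun A U p = (SUP a\<in>A. ereal (\<Sum>\<omega>\<in>UNIV. p $ \<omega> * U a \<omega>))"

definition finite_valued :: "'a set \<Rightarrow> ('a \<Rightarrow> 'w::finite \<Rightarrow> real) \<Rightarrow> bool"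
  where "finite_valued A U \<longleftrightarrow> (\<forall>p\<in>beliefs. \<bar>value_fun A U p\<bar> \<noteq> \<infinity>)"

definition posterior_dists :: "(real ^ 'w::finite) measure set"
  where "posterior_dists = space (prob_algebra (restrict_space borel beliefs))"

(* Meaningful only for finite_valued problems. A finite value function is bounded and Borel
   on beliefs, so the Bochner integrals exist and are not affected by the library convention
   that non-integrable functions have integral 0; real_of_ereal then loses nothing. *)
definition VoI :: "'a set \<Rightarrow> ('a \<Rightarrow> 'w::finite \<Rightarrow> real) \<Rightarrow> (real ^ 'w) measure \<Rightarrow> real"
  where "VoI A U Q =
    (\<integral>p. real_of_ereal (value_fun A U p) \<partial>Q) - real_of_ereal (value_fun A U (\<integral>p. p \<partial>Q))"

definition sum_utility ::
    "('l \<Rightarrow> 'w::finite \<Rightarrow> real) \<Rightarrow> ('n \<Rightarrow> 'w \<Rightarrow> real) \<Rightarrow> 'l \<times> 'n \<Rightarrow> 'w \<Rightarrow> real"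
  where "sum_utility U\<^sub>L U\<^sub>N = (\<lambda>(l, n) \<omega>. U\<^sub>L l \<omega> + U\<^sub>N n \<omega>)"

end

theory Submission
  imports Defs
begin

text \<open>
  Both directions compare the convex functions \<open>V\<^sub>M\<close> and \<open>V\<^sub>L\<close> through the difference
  \<open>D = V\<^sub>M - V\<^sub>L\<close> on the simplex of beliefs.

  A supremum over a product of a separable utility is the sum of the two suprema
  (\<open>value_fun_sum_utility\<close>), so (2) says precisely that \<open>D\<close> is the value function of some decision
  problem \<open>N\<close>. The value of information is additive in the value function, and it is nonnegative
  for every decision problem: each single action has a payoff that is linear in the belief, hence
  the same on average as at the barycenter, so the freedom to adapt the action to the posterior can
  only help (\<open>VoI_nonneg\<close>). This gives (2) \<open>\<Longrightarrow>\<close> (1).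

  Conversely, (1) applied to distributions with two atoms is exactly Jensen's inequality with two
  weights for \<open>D\<close>, so \<open>D\<close> is convex (\<open>convex_on_value_difference\<close>). A convex function is a
  supremum of affine minorants as soon as its epigraph is closed (\<open>linear_minorant\<close>, by
  separation), and affine functions on the simplex are restrictions of linear ones, that is,
  payoffs of actions. Hence the set of all linear minorants of \<open>D\<close>, with a minorant \<open>x\<close> paying
  \<open>x $ \<omega>\<close> in state \<open>\<omega>\<close>, is a decision problem with value function \<open>D\<close>
  (\<open>convex_imp_value_fun\<close>).

  The delicate point is the closed epigraph: as \<open>D\<close> is a difference, lower semicontinuity of
  suprema of linear functions does not suffice, and \<open>V\<^sub>L\<close> must be upper semicontinuous up to the
  boundary of the simplex. This is where the polyhedral shape of the simplex enters
  (\<open>continuous_on_real_value\<close>). The same continuity makes all integrals converge.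
\<close>

definition real_value :: "'a set \<Rightarrow> ('a \<Rightarrow> 'w::finite \<Rightarrow> real) \<Rightarrow> real ^ 'w \<Rightarrow> real"
  where "real_value A U p = real_of_ereal (value_fun A U p)"

lemma payoff_eq_inner: "(\<Sum>\<omega>\<in>UNIV. p $ \<omega> * u \<omega>) = inner p (vec_lambda u)"
  for p :: "real ^ 'w::finite"
  by (simp add: inner_vec_def)

section \<open>The simplex of beliefs\<close>

lemma beliefs_nonneg: "p \<in> beliefs \<Longrightarrow> 0 \<le> p $ \<omega>"
  by (simp add: beliefs_def)

lemma beliefs_sum: "p \<in> beliefs \<Longrightarrow> (\<Sum>\<omega>\<in>UNIV. p $ \<omega>) = 1"
  by (simp add: beliefs_def)

lemma axis_in_beliefs: "axis \<omega> 1 \<in> beliefs"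
  by (simp add: beliefs_def axis_def)

lemma convex_beliefs: "convex (beliefs :: (real ^ 'w::finite) set)"
  unfolding convex_def by (auto simp: beliefs_def sum.distrib sum_distrib_left[symmetric])

lemma compact_beliefs: "compact (beliefs :: (real ^ 'w::finite) set)"
proof -
  have "closed (beliefs :: (real ^ 'w) set)"
    unfolding beliefs_def
    by (intro closed_Collect_conj closed_Collect_all closed_Collect_le closed_Collect_eq
        continuous_intros)
  moreover have "norm p \<le> 1" if "p \<in> beliefs" for p :: "real ^ 'w"
    using norm_le_l1_cart[of p] that by (simp add: beliefs_nonneg beliefs_sum)
  then have "bounded (beliefs :: (real ^ 'w) set)"
    by (rule boundedI)
  ultimately show ?thesis
    by (simp add: compact_eq_bounded_closed)
qed

section \<open>Finite value functions\<close>

lemma value_fun_eq_real_value: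
  assumes "finite_valued A U" "p \<in> beliefs"
  shows "value_fun A U p = ereal (real_value A U p)"
  using assms unfolding finite_valued_def real_value_def by (simp add: ereal_real')

lemma payoff_le_real_value:
  assumes "finite_valued A U" "p \<in> beliefs" "a \<in> A"
  shows "inner p (vec_lambda (U a)) \<le> real_value A U p"
proof -
  have "ereal (inner p (vec_lambda (U a))) \<le> value_fun A U p"
    unfolding value_fun_def payoff_eq_inner using assms(3) by (intro SUP_upper)
  then show ?thesis using value_fun_eq_real_value[OF assms(1,2)] by simp
qed

lemma less_real_valueD:
  assumes "finite_valued A U" "p \<in> beliefs" "c < real_value A U p"
  shows "\<exists>a\<in>A. c < inner p (vec_lambda (U a))"
proof -
  have "ereal c < value_fun A U p"
    using value_fun_eq_real_value[OF assms(1,2)] assms(3) by simp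
  then show ?thesis
    unfolding value_fun_def payoff_eq_inner less_SUP_iff by simp
qed

lemma real_value_le:
  assumes "finite_valued A U" "p \<in> beliefs"
    and "\<And>a. a \<in> A \<Longrightarrow> inner p (vec_lambda (U a)) \<le> c"
  shows "real_value A U p \<le> c"
proof (rule ccontr)
  assume "\<not> real_value A U p \<le> c"
  then obtain a where "a \<in> A" "c < inner p (vec_lambda (U a))"
    using less_real_valueD[OF assms(1,2), of c] by auto
  then show False using assms(3)[of a] by simp
qed

text \<open>
  Finiteness at the vertices of the simplex, where the belief is certain of one state, already
  bounds the utilities uniformly from above. They need not be bounded from below.
\<close>

lemma utility_bounded_above:
  fixes U :: "'a \<Rightarrow> 'w::finite \<Rightarrow> real"
  assumes "finite_valued A U"
  shows "\<exists>B. \<forall>a\<in>A. \<forall>\<omega>. U a \<omega> \<le> B"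
proof -
  have "U a \<omega> \<le> Max (range (\<lambda>\<omega>. real_value A U (axis \<omega> 1)))" if "a \<in> A" for a \<omega>
  proof -
    have "U a \<omega> \<le> real_value A U (axis \<omega> 1)"
      using payoff_le_real_value[OF assms axis_in_beliefs that, of \<omega>] by (simp add: inner_axis')
    also have "\<dots> \<le> Max (range (\<lambda>\<omega>. real_value A U (axis \<omega> 1)))"
      by (intro Max_ge) auto
    finally show ?thesis .
  qed
  then show ?thesis by blast
qed

text \<open>
  Lower semicontinuity holds for every supremum of continuous functions. For upper semicontinuity
  at \<open>p\<close>, including boundary points: if \<open>t < 1\<close>, then every belief \<open>q\<close> close to \<open>p\<close> dominates
  \<open>t p\<close> in each coordinate, trivially where \<open>p\<close> vanishes. The remaining mass \<open>1 - t\<close> of \<open>q\<close> earns at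
  most the uniform bound \<open>B\<close> of the utilities, so the value at \<open>q\<close> is at most
  \<open>t V(p) + (1 - t) B\<close>, which is as close to \<open>V(p)\<close> as desired.
\<close>

lemma continuous_on_real_value:
  fixes U :: "'a \<Rightarrow> 'w::finite \<Rightarrow> real"
  assumes fin: "finite_valued A U"
  shows "continuous_on beliefs (real_value A U)"
  unfolding continuous_on_def
proof (intro ballI order_tendstoI)
  fix p :: "real ^ 'w" and c
  assume p: "p \<in> beliefs" and c: "c < real_value A U p"
  then obtain a where a: "a \<in> A" "c < inner p (vec_lambda (U a))"
    using less_real_valueD[OF fin p c] by blast
  have "((\<lambda>q. inner q (vec_lambda (U a))) \<longlongrightarrow> inner p (vec_lambda (U a))) (at p within beliefs)"
    by (intro tendsto_intros)
  then have "\<forall>\<^sub>F q in at p within beliefs. c < inner q (vec_lambda (U a))"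
    using a(2) by (rule order_tendstoD)
  moreover have "\<forall>\<^sub>F q in at p within beliefs. q \<in> beliefs"
    by (simp add: eventually_at_filter)
  ultimately show "\<forall>\<^sub>F q in at p within beliefs. c < real_value A U q"
  proof eventually_elim
    case (elim q)
    then show ?case using payoff_le_real_value[OF fin elim(2) a(1)] by linarith
  qed
next
  fix p :: "real ^ 'w" and c
  assume p: "p \<in> beliefs" and c: "real_value A U p < c"
  obtain B where B: "\<And>a \<omega>. a \<in> A \<Longrightarrow> U a \<omega> \<le> B"
    using utility_bounded_above[OF fin] by blast
  have "((\<lambda>t. t * real_value A U p + (1 - t) * B) \<longlongrightarrow> 1 * real_value A U p + (1 - 1) * B)
      (at_left 1)"
    by (intro tendsto_intros)
  then have "\<forall>\<^sub>F t in at_left 1. t * real_value A U p + (1 - t) * B < c"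
    using c by (intro order_tendstoD) auto
  moreover have "\<forall>\<^sub>F t in at_left (1::real). t \<in> {0<..<1}"
    by (rule eventually_at_left_real) simp
  ultimately have "\<forall>\<^sub>F t in at_left 1. 0 < t \<and> t < 1 \<and> t * real_value A U p + (1 - t) * B < c"
    by eventually_elim simp
  then obtain t where t: "0 < t" "t < 1" "t * real_value A U p + (1 - t) * B < c"
    using eventually_happens'[OF trivial_limit_at_left_real] by blast
  have "\<forall>\<^sub>F q in at p within beliefs. t * p $ \<omega> \<le> q $ \<omega>" for \<omega>
  proof (cases "p $ \<omega> = 0")
    case True
    then show ?thesis by (simp add: eventually_at_filter beliefs_nonneg)
  next
    case False
    then have "t * p $ \<omega> < p $ \<omega>"
      using t(2) beliefs_nonneg[OF p, of \<omega>] by simp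
    moreover have "((\<lambda>q. q $ \<omega>) \<longlongrightarrow> p $ \<omega>) (at p within beliefs)"
      by (intro tendsto_intros)
    ultimately have "\<forall>\<^sub>F q in at p within beliefs. t * p $ \<omega> < q $ \<omega>"
      by (rule order_tendstoD(1)[rotated])
    then show ?thesis by eventually_elim simp
  qed
  then have "\<forall>\<^sub>F q in at p within beliefs. \<forall>\<omega>. t * p $ \<omega> \<le> q $ \<omega>"
    by (rule eventually_all_finite)
  moreover have "\<forall>\<^sub>F q in at p within beliefs. q \<in> beliefs"
    by (simp add: eventually_at_filter)
  ultimately show "\<forall>\<^sub>F q in at p within beliefs. real_value A U q < c"
  proof eventually_elim
    case (elim q)
    have "real_value A U q \<le> t * real_value A U p + (1 - t) * B"
    proof (rule real_value_le[OF fin elim(2)])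
      fix a assume a: "a \<in> A"
      have "inner (q - t *\<^sub>R p) (vec_lambda (U a)) = (\<Sum>\<omega>\<in>UNIV. (q $ \<omega> - t * p $ \<omega>) * U a \<omega>)"
        by (simp add: inner_vec_def)
      also have "\<dots> \<le> (\<Sum>\<omega>\<in>UNIV. (q $ \<omega> - t * p $ \<omega>) * B)"
        using elim(1) B[OF a] by (intro sum_mono mult_left_mono) auto
      also have "\<dots> = ((\<Sum>\<omega>\<in>UNIV. q $ \<omega>) - t * (\<Sum>\<omega>\<in>UNIV. p $ \<omega>)) * B"
        unfolding sum_distrib_right[symmetric] sum_subtractf sum_distrib_left[symmetric] ..
      also have "\<dots> = (1 - t) * B"
        unfolding beliefs_sum[OF p] beliefs_sum[OF elim(2)] by simp
      finally have "inner q (vec_lambda (U a)) \<le> t * inner p (vec_lambda (U a)) + (1 - t) * B"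
        by (simp add: inner_diff_left)
      also have "\<dots> \<le> t * real_value A U p + (1 - t) * B"
        using payoff_le_real_value[OF fin p a] t(1) by simp
      finally show "inner q (vec_lambda (U a)) \<le> t * real_value A U p + (1 - t) * B" .
    qed
    then show ?case using t(3) by simp
  qed
qed

lemma value_fun_sum_utility:
  fixes U\<^sub>L :: "'l \<Rightarrow> 'w::finite \<Rightarrow> real" and U\<^sub>N :: "'n \<Rightarrow> 'w \<Rightarrow> real"
  assumes L: "finite_valued A\<^sub>L U\<^sub>L" and N: "finite_valued A\<^sub>N U\<^sub>N" and p: "p \<in> beliefs"
    and "A\<^sub>L \<noteq> {}" and "A\<^sub>N \<noteq> {}"
  shows "value_fun (A\<^sub>L \<times> A\<^sub>N) (sum_utility U\<^sub>L U\<^sub>N) p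
    = ereal (real_value A\<^sub>L U\<^sub>L p + real_value A\<^sub>N U\<^sub>N p)"
proof -
  let ?l = "\<lambda>l. ereal (inner p (vec_lambda (U\<^sub>L l)))"
  let ?n = "\<lambda>n. ereal (inner p (vec_lambda (U\<^sub>N n)))"
  have l: "(SUP l\<in>A\<^sub>L. ?l l) = ereal (real_value A\<^sub>L U\<^sub>L p)"
    using value_fun_eq_real_value[OF L p] unfolding value_fun_def payoff_eq_inner .
  have n: "(SUP n\<in>A\<^sub>N. ?n n) = ereal (real_value A\<^sub>N U\<^sub>N p)"
    using value_fun_eq_real_value[OF N p] unfolding value_fun_def payoff_eq_inner .
  have "vec_lambda (sum_utility U\<^sub>L U\<^sub>N (l, n)) = vec_lambda (U\<^sub>L l) + vec_lambda (U\<^sub>N n)" for l n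
    by (simp add: vec_eq_iff sum_utility_def)
  then have "ereal (inner p (vec_lambda (sum_utility U\<^sub>L U\<^sub>N x))) = ?l (fst x) + ?n (snd x)" for x
    by (cases x) (simp add: inner_add_right)
  then have "value_fun (A\<^sub>L \<times> A\<^sub>N) (sum_utility U\<^sub>L U\<^sub>N) p = (SUP x\<in>A\<^sub>L \<times> A\<^sub>N. ?l (fst x) + ?n (snd x))"
    unfolding value_fun_def payoff_eq_inner by (rule SUP_cong[OF refl])
  also have "\<dots> = (SUP l\<in>A\<^sub>L. SUP n\<in>A\<^sub>N. ?l l + ?n n)"
    by (rule SUP_pair[symmetric])
  also have "\<dots> = (SUP l\<in>A\<^sub>L. ?l l + (SUP n\<in>A\<^sub>N. ?n n))"
    using assms(5) by (intro SUP_cong refl SUP_ereal_add_right) simp_all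
  also have "\<dots> = (SUP l\<in>A\<^sub>L. ?l l) + (SUP n\<in>A\<^sub>N. ?n n)"
    using assms(4) by (rule SUP_ereal_add_left) (simp add: n)
  finally show ?thesis
    by (simp add: l n)
qed

section \<open>Information has nonnegative value\<close>

lemma posterior_dists_iff:
  "Q \<in> posterior_dists \<longleftrightarrow> prob_space Q \<and> sets Q = sets (restrict_space borel beliefs)"
  by (auto simp: posterior_dists_def space_prob_algebra)

lemma space_posterior_dist: "Q \<in> posterior_dists \<Longrightarrow> space Q = beliefs"
  using sets_eq_imp_space_eq[of Q "restrict_space borel beliefs"]
  by (simp add: posterior_dists_iff space_restrict_space)

text \<open>
  On the compact simplex, continuous functions are bounded and measurable, so a probability
  distribution integrates them. Here \<open>f\<close> may also be the identity, whose integral is the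
  barycenter.
\<close>

lemma integrable_posterior_dist:
  fixes f :: "real ^ 'w::finite \<Rightarrow> 'b::{banach, second_countable_topology}"
  assumes Q: "Q \<in> posterior_dists" and f: "continuous_on beliefs f"
  shows "integrable Q f"
proof -
  interpret prob_space Q using Q by (simp add: posterior_dists_iff)
  have "f \<in> borel_measurable (restrict_space borel beliefs)"
    using f by (rule borel_measurable_continuous_on_restrict)
  then have "f \<in> borel_measurable Q"
    using Q by (simp add: posterior_dists_iff cong: measurable_cong_sets)
  moreover obtain B where "\<And>p. p \<in> beliefs \<Longrightarrow> norm (f p) \<le> B"
    using compact_imp_bounded[OF compact_continuous_image[OF f compact_beliefs]]
    by (auto simp: bounded_iff)
  ultimately show ?thesis
    using Q by (intro integrable_const_bound[of _ B] AE_I2) (simp_all add: space_posterior_dist)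
qed

lemma barycenter_inner:
  assumes "Q \<in> posterior_dists"
  shows "inner (\<integral>p. p \<partial>Q) u = (\<integral>p. inner p u \<partial>Q)"
  using integral_inner_left[OF integrable_posterior_dist[OF assms continuous_on_id], of u] by simp

lemma barycenter_in_beliefs:
  fixes Q :: "(real ^ 'w::finite) measure"
  assumes Q: "Q \<in> posterior_dists"
  shows "(\<integral>p. p \<partial>Q) \<in> beliefs"
proof -
  interpret prob_space Q using Q by (simp add: posterior_dists_iff)
  have "0 \<le> (\<integral>p. p \<partial>Q) $ \<omega>" for \<omega>
  proof -
    have "0 \<le> (\<integral>p. inner p (axis \<omega> 1) \<partial>Q)"
      by (intro Bochner_Integration.integral_nonneg)
        (simp add: inner_axis space_posterior_dist[OF Q] beliefs_nonneg)
    then show ?thesis unfolding barycenter_inner[OF Q, symmetric] by (simp add: inner_axis)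
  qed
  moreover have "(\<Sum>\<omega>\<in>UNIV. (\<integral>p. p \<partial>Q) $ \<omega>) = 1"
  proof -
    have one: "(\<Sum>\<omega>\<in>UNIV. p $ \<omega>) = inner p 1" for p :: "real ^ 'w"
      by (simp add: inner_vec_def)
    have "inner (\<integral>p. p \<partial>Q) 1 = (\<integral>p. 1 \<partial>Q)"
      unfolding barycenter_inner[OF Q]
      by (intro Bochner_Integration.integral_cong)
        (simp_all add: space_posterior_dist[OF Q] one[symmetric] beliefs_sum)
    then show ?thesis by (simp add: one prob_space)
  qed
  ultimately show ?thesis by (simp add: beliefs_def)
qed

text \<open>
  Jensen's inequality. A value function is a supremum of payoffs that commute with the
  integral, so it suffices to integrate the bound of each payoff by the supremum.
\<close>

lemma VoI_nonneg:
  fixes U :: "'a \<Rightarrow> 'w::finite \<Rightarrow> real"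
  assumes fin: "finite_valued A U" and Q: "Q \<in> posterior_dists"
  shows "0 \<le> VoI A U Q"
proof -
  have "real_value A U (\<integral>p. p \<partial>Q) \<le> (\<integral>p. real_value A U p \<partial>Q)"
  proof (rule real_value_le[OF fin barycenter_in_beliefs[OF Q]])
    fix a assume a: "a \<in> A"
    show "inner (\<integral>p. p \<partial>Q) (vec_lambda (U a)) \<le> (\<integral>p. real_value A U p \<partial>Q)"
      unfolding barycenter_inner[OF Q]
      by (intro integral_mono integrable_posterior_dist[OF Q] continuous_on_real_value[OF fin]
          continuous_intros)
        (simp add: space_posterior_dist[OF Q] payoff_le_real_value[OF fin _ a])
  qed
  then show ?thesis unfolding VoI_def real_value_def[symmetric] by linarith
qed

lemma VoI_add:
  assumes Q: "Q \<in> posterior_dists"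
    and L: "finite_valued A\<^sub>L U\<^sub>L" and N: "finite_valued A\<^sub>N U\<^sub>N"
    and sum: "\<And>p. p \<in> beliefs \<Longrightarrow> real_value A\<^sub>M U\<^sub>M p = real_value A\<^sub>L U\<^sub>L p + real_value A\<^sub>N U\<^sub>N p"
  shows "VoI A\<^sub>M U\<^sub>M Q = VoI A\<^sub>L U\<^sub>L Q + VoI A\<^sub>N U\<^sub>N Q"
proof -
  have "(\<integral>p. real_value A\<^sub>M U\<^sub>M p \<partial>Q) = (\<integral>p. real_value A\<^sub>L U\<^sub>L p + real_value A\<^sub>N U\<^sub>N p \<partial>Q)"
    by (intro Bochner_Integration.integral_cong) (simp_all add: space_posterior_dist[OF Q] sum)
  also have "\<dots> = (\<integral>p. real_value A\<^sub>L U\<^sub>L p \<partial>Q) + (\<integral>p. real_value A\<^sub>N U\<^sub>N p \<partial>Q)"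
    by (intro Bochner_Integration.integral_add integrable_posterior_dist[OF Q]
        continuous_on_real_value L N)
  finally show ?thesis
    using sum[OF barycenter_in_beliefs[OF Q]] unfolding VoI_def real_value_def[symmetric]
    by linarith
qed

lemma VoI_mono_if_decomposed:
  fixes U\<^sub>L :: "'l \<Rightarrow> 'w::finite \<Rightarrow> real" and U\<^sub>N :: "'n \<Rightarrow> 'w \<Rightarrow> real"
  assumes "finite_valued A\<^sub>L U\<^sub>L" "finite_valued A\<^sub>N U\<^sub>N" "A\<^sub>L \<noteq> {}" "A\<^sub>N \<noteq> {}"
    and "\<forall>p\<in>beliefs. value_fun (A\<^sub>L \<times> A\<^sub>N) (sum_utility U\<^sub>L U\<^sub>N) p = value_fun A\<^sub>M U\<^sub>M p"
    and Q: "Q \<in> posterior_dists"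
  shows "VoI A\<^sub>L U\<^sub>L Q \<le> VoI A\<^sub>M U\<^sub>M Q"
proof -
  have "real_value A\<^sub>M U\<^sub>M p = real_value A\<^sub>L U\<^sub>L p + real_value A\<^sub>N U\<^sub>N p" if "p \<in> beliefs" for p
    unfolding real_value_def[of A\<^sub>M] assms(5)[rule_format, OF that, symmetric]
      value_fun_sum_utility[OF assms(1,2) that assms(3,4)] by simp
  then have "VoI A\<^sub>M U\<^sub>M Q = VoI A\<^sub>L U\<^sub>L Q + VoI A\<^sub>N U\<^sub>N Q"
    by (rule VoI_add[OF Q assms(1,2)])
  then show ?thesis using VoI_nonneg[OF assms(2) Q] by simp
qed

section \<open>Two-point experiments\<close>

text \<open>
  The distribution is the image of a coin toss rather than a combination of point
  measures: this places it on the restricted sigma-algebra of the simplex and reduces its integrals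
  to sums over two outcomes.
\<close>

definition two_point :: "real \<Rightarrow> real ^ 'w::finite \<Rightarrow> real ^ 'w \<Rightarrow> (real ^ 'w) measure"
  where "two_point t p q =
    distr (bernoulli_pmf t) (restrict_space borel beliefs) (\<lambda>b. if b then p else q)"

lemma two_point_in_posterior_dists:
  assumes "p \<in> beliefs" "q \<in> beliefs"
  shows "two_point t p q \<in> posterior_dists"
  unfolding posterior_dists_iff two_point_def using assms
  by (auto intro!: measure_pmf.prob_space_distr simp: space_restrict_space)

lemma integral_two_point:
  fixes f :: "real ^ 'w::finite \<Rightarrow> 'b::{banach, second_countable_topology}"
  assumes "p \<in> beliefs" "q \<in> beliefs" "t \<in> {0..1}" and f: "continuous_on beliefs f"
  shows "(\<integral>r. f r \<partial>two_point t p q) = t *\<^sub>R f p + (1 - t) *\<^sub>R f q"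
proof -
  have "(\<integral>r. f r \<partial>two_point t p q) = (\<integral>b. f (if b then p else q) \<partial>bernoulli_pmf t)"
    unfolding two_point_def using assms
    by (intro integral_distr borel_measurable_continuous_on_restrict)
      (auto simp: space_restrict_space)
  also have "\<dots> = t *\<^sub>R f p + (1 - t) *\<^sub>R f q"
    using assms(3) by (subst integral_measure_pmf[of UNIV]) (auto simp: UNIV_bool)
  finally show ?thesis .
qed

lemma VoI_two_point:
  assumes "finite_valued A U" "p \<in> beliefs" "q \<in> beliefs" "t \<in> {0..1}"
  shows "VoI A U (two_point t p q) = t * real_value A U p + (1 - t) * real_value A U q
    - real_value A U (t *\<^sub>R p + (1 - t) *\<^sub>R q)"
  unfolding VoI_def real_value_def[symmetric]
  using integral_two_point[OF assms(2-4) continuous_on_real_value[OF assms(1)]]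
    integral_two_point[OF assms(2-4) continuous_on_id]
  by simp

text \<open>
  For an experiment with two outcomes, the value of information is the gap in Jensen's inequality
  for the value function. Comparing the gaps of \<open>M\<close> and \<open>L\<close> leaves that of the difference.
\<close>

lemma convex_on_value_difference:
  fixes U\<^sub>M :: "'m \<Rightarrow> 'w::finite \<Rightarrow> real" and U\<^sub>L :: "'l \<Rightarrow> 'w \<Rightarrow> real"
  assumes "finite_valued A\<^sub>M U\<^sub>M" "finite_valued A\<^sub>L U\<^sub>L"
    and "\<forall>Q\<in>posterior_dists. VoI A\<^sub>L U\<^sub>L Q \<le> VoI A\<^sub>M U\<^sub>M Q"
  shows "convex_on beliefs (\<lambda>p. real_value A\<^sub>M U\<^sub>M p - real_value A\<^sub>L U\<^sub>L p)"
proof (rule convex_onI[OF _ convex_beliefs])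
  fix t :: real and p q :: "real ^ 'w"
  assume t: "0 < t" "t < 1" and pq: "p \<in> beliefs" "q \<in> beliefs"
  have "VoI A\<^sub>L U\<^sub>L (two_point (1 - t) p q) \<le> VoI A\<^sub>M U\<^sub>M (two_point (1 - t) p q)"
    using assms(3) two_point_in_posterior_dists[OF pq] by blast
  then show "real_value A\<^sub>M U\<^sub>M ((1 - t) *\<^sub>R p + t *\<^sub>R q) - real_value A\<^sub>L U\<^sub>L ((1 - t) *\<^sub>R p + t *\<^sub>R q)
    \<le> (1 - t) * (real_value A\<^sub>M U\<^sub>M p - real_value A\<^sub>L U\<^sub>L p) + t * (real_value A\<^sub>M U\<^sub>M q - real_value A\<^sub>L U\<^sub>L q)"
    using t assms(1,2) pq by (simp add: VoI_two_point algebra_simps)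
qed

section \<open>Continuous convex functions are value functions\<close>

text \<open>
  The point \<open>(p, c)\<close> lies strictly below the closed convex epigraph of \<open>D\<close> and is separated from
  it by a hyperplane with normal \<open>(v, s)\<close>. The hyperplane is not vertical, because \<open>(p, D p)\<close> and
  \<open>(p, c)\<close> lie on different sides of it, also when \<open>p\<close> is on the boundary of the simplex. It is
  therefore the graph of an affine minorant of \<open>D\<close>.
\<close>

lemma linear_minorant:
  fixes D :: "real ^ 'w::finite \<Rightarrow> real"
  assumes cvx: "convex_on beliefs D" and cont: "continuous_on beliefs D"
    and p: "p \<in> beliefs" and c: "c < D p"
  shows "\<exists>x. (\<forall>q\<in>beliefs. inner q x \<le> D q) \<and> c < inner p x"
proof -
  have "closed {z \<in> beliefs \<times> UNIV. D (fst z) \<le> snd z}"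
    using cont compact_imp_closed[OF compact_beliefs]
    by (intro continuous_on_closed_Collect_le closed_Times continuous_intros)
      (auto intro: continuous_on_compose2[OF cont continuous_on_fst[OF continuous_on_id]])
  moreover have "{z \<in> beliefs \<times> UNIV. D (fst z) \<le> snd z} = epigraph beliefs D"
    by (auto simp: epigraph_def)
  ultimately have "closed (epigraph beliefs D)" by simp
  moreover have "convex (epigraph beliefs D)"
    using cvx convex_beliefs by (simp add: convex_epigraph)
  moreover have "(p, c) \<notin> epigraph beliefs D"
    using c by (simp add: epigraph_def)
  ultimately obtain u b where ub: "inner u (p, c) < b" "\<forall>z\<in>epigraph beliefs D. inner u z > b"
    using separating_hyperplane_closed_point by blast
  obtain v s where u: "u = (v, s)" by (cases u)
  have above: "b < inner v q + s * D q" if "q \<in> beliefs" for q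
    using ub(2) that by (auto simp: epigraph_def u inner_prod_def)
  have below: "inner v p + s * c < b"
    using ub(1) by (simp add: u inner_prod_def)
  have "0 < s * (D p - c)"
    using above[OF p] below by (simp add: algebra_simps)
  then have s: "0 < s"
    using c by (simp add: zero_less_mult_iff)
  \<comment> \<open>The constant term of the affine minorant becomes linear, since the coordinates of a belief
    add up to 1.\<close>
  define x where "x = (1 / s) *\<^sub>R (b *\<^sub>R 1 - v)"
  have x: "inner q x = (b - inner v q) / s" if "q \<in> beliefs" for q
  proof -
    have "inner q 1 = 1"
      using beliefs_sum[OF that] by (simp add: inner_vec_def)
    then show ?thesis by (simp add: x_def inner_diff_right inner_commute)
  qed
  have "inner q x \<le> D q" if "q \<in> beliefs" for q
    using above[OF that] s unfolding x[OF that] by (simp add: field_simps)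
  moreover have "c < inner p x"
    using below s unfolding x[OF p] by (simp add: field_simps)
  ultimately show ?thesis by blast
qed

lemma convex_imp_value_fun:
  fixes D :: "real ^ 'w::finite \<Rightarrow> real"
  assumes "convex_on beliefs D" "continuous_on beliefs D" "p \<in> beliefs"
  shows "value_fun {x. \<forall>q\<in>beliefs. inner q x \<le> D q} vec_nth p = ereal (D p)"
  unfolding value_fun_def payoff_eq_inner vec_nth_inverse
proof (rule SUP_eqI)
  show "ereal (inner p x) \<le> ereal (D p)" if "x \<in> {x. \<forall>q\<in>beliefs. inner q x \<le> D q}" for x
    using that assms(3) by simp
next
  fix y assume y: "\<And>x. x \<in> {x. \<forall>q\<in>beliefs. inner q x \<le> D q} \<Longrightarrow> ereal (inner p x) \<le> y"
  show "ereal (D p) \<le> y"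
  proof (rule ccontr)
    assume "\<not> ereal (D p) \<le> y"
    then have "y < ereal (D p)" by (simp add: not_le)
    then obtain c where c: "y < ereal c" "c < D p"
      using ereal_dense2[of y "ereal (D p)"] by auto
    obtain x where x: "\<forall>q\<in>beliefs. inner q x \<le> D q" "c < inner p x"
      using linear_minorant[OF assms c(2)] by blast
    have "ereal c < ereal (inner p x)" using x(2) by simp
    also have "\<dots> \<le> y" using x(1) by (intro y) simp
    finally show False using c(1) by simp
  qed
qed

section \<open>More valuable information as an added decision problem\<close>

(* HOL cannot quantify existentially over the type of the actions of N. The equivalence is
   therefore stated with the witness A_N in real ^ 'w, and the second part of the conclusion
   gives the implication from (2) to (1) for A_N in an arbitrary type 'n. *)
theorem theorem1:
  fixes A\<^sub>M :: "'m set" and U\<^sub>M :: "'m \<Rightarrow> 'w::finite \<Rightarrow> real"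
    and A\<^sub>L :: "'l set" and U\<^sub>L :: "'l \<Rightarrow> 'w \<Rightarrow> real"
  assumes "A\<^sub>M \<noteq> {}" and "A\<^sub>L \<noteq> {}"
    and "finite_valued A\<^sub>M U\<^sub>M" and "finite_valued A\<^sub>L U\<^sub>L"
  shows "((\<forall>Q\<in>posterior_dists. VoI A\<^sub>M U\<^sub>M Q \<ge> VoI A\<^sub>L U\<^sub>L Q) \<longleftrightarrow>
      (\<exists>(A\<^sub>N :: (real ^ 'w) set) (U\<^sub>N :: real ^ 'w \<Rightarrow> 'w \<Rightarrow> real).
        A\<^sub>N \<noteq> {} \<and> finite_valued A\<^sub>N U\<^sub>N \<and>
        (\<forall>p\<in>beliefs. value_fun (A\<^sub>L \<times> A\<^sub>N) (sum_utility U\<^sub>L U\<^sub>N) p = value_fun A\<^sub>M U\<^sub>M p)))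
    \<and> ((\<exists>(A\<^sub>N :: 'n set) (U\<^sub>N :: 'n \<Rightarrow> 'w \<Rightarrow> real).
        A\<^sub>N \<noteq> {} \<and> finite_valued A\<^sub>N U\<^sub>N \<and>
        (\<forall>p\<in>beliefs. value_fun (A\<^sub>L \<times> A\<^sub>N) (sum_utility U\<^sub>L U\<^sub>N) p = value_fun A\<^sub>M U\<^sub>M p))
      \<longrightarrow> (\<forall>Q\<in>posterior_dists. VoI A\<^sub>M U\<^sub>M Q \<ge> VoI A\<^sub>L U\<^sub>L Q))"
proof (intro conjI iffI impI)
  assume voi: "\<forall>Q\<in>posterior_dists. VoI A\<^sub>M U\<^sub>M Q \<ge> VoI A\<^sub>L U\<^sub>L Q"
  define D where "D p = real_value A\<^sub>M U\<^sub>M p - real_value A\<^sub>L U\<^sub>L p" for p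
  define A\<^sub>N where "A\<^sub>N = {x. \<forall>q\<in>beliefs. inner q x \<le> D q}"
  have cvx: "convex_on beliefs D"
    using convex_on_value_difference[OF assms(3,4)] voi unfolding D_def by blast
  have cont: "continuous_on beliefs D"
    unfolding D_def by (intro continuous_intros continuous_on_real_value assms(3,4))
  have N: "value_fun A\<^sub>N vec_nth p = ereal (D p)" if "p \<in> beliefs" for p
    unfolding A\<^sub>N_def using cvx cont that by (rule convex_imp_value_fun)
  have fin: "finite_valued A\<^sub>N vec_nth"
    by (simp add: finite_valued_def N)
  have "A\<^sub>N \<noteq> {}"
  proof
    assume "A\<^sub>N = {}"
    then have "value_fun A\<^sub>N vec_nth (axis undefined 1) = - \<infinity>"
      by (simp add: value_fun_def bot_ereal_def)
    then show False using N[OF axis_in_beliefs] by simp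
  qed
  moreover have "value_fun (A\<^sub>L \<times> A\<^sub>N) (sum_utility U\<^sub>L vec_nth) p = value_fun A\<^sub>M U\<^sub>M p"
    if p: "p \<in> beliefs" for p
    using value_fun_sum_utility[OF assms(4) fin p assms(2) \<open>A\<^sub>N \<noteq> {}\<close>] N[OF p]
      value_fun_eq_real_value[OF assms(3) p]
    by (simp add: real_value_def[of A\<^sub>N] D_def)
  ultimately show "\<exists>(A\<^sub>N :: (real ^ 'w) set) (U\<^sub>N :: real ^ 'w \<Rightarrow> 'w \<Rightarrow> real).
      A\<^sub>N \<noteq> {} \<and> finite_valued A\<^sub>N U\<^sub>N \<and>
      (\<forall>p\<in>beliefs. value_fun (A\<^sub>L \<times> A\<^sub>N) (sum_utility U\<^sub>L U\<^sub>N) p = value_fun A\<^sub>M U\<^sub>M p)"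
    using fin by blast
qed (use VoI_mono_if_decomposed[OF assms(4) _ assms(2)] in metis)+

end
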